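(* Let $N,S\ge1$ be integers, let $\{\phi_j\}_{j=1}^N$ be an orthonormal basis of $\mathbb{C}^N$, let $\{f_j\}_{j=1}^S$ be an arbitrary collection of vectors in $\mathbb{C}^N$, and let $\mathfrak{g}\in\mathbb{C}^N$. Let $\Phi$ be the $N\times N$ matrix whose $j$-th column is $\phi_j$, and define $A_i=\Phi D_{f_i}\Phi^*$ for $i=1,\dots,S$. For $m=1,\dots,S$ and $\ell=1,\dots,N$ let $\mathfrak{g}_{m,\ell}:=\phi_\ell\circ(A_m\mathfrak{g})$. Let $F$ be the $N\times S$ matrix whose $j$-th column is $f_j$, let $\mu_j:=(\overline{\phi_k(j)})_{k=1}^N\in\mathbb{C}^N$ for $j=1,\dots,N$, and let $\widehat{\mathfrak{g}}=\Phi^*\mathfrak{g}$. Then for every $\mathfrak{f}\in\mathbb{C}^N$, $$A\,\|\mathfrak{f}\|_2^2\le\sum_{m=1}^S\sum_{\ell=1}^N|\langle\mathfrak{f},\mathfrak{g}_{m,\ell}\rangle|^2\le B\,\|\mathfrak{f}\|_2^2,$$ where $$A=\min_{1\le k\le N}\big\|F^*(\mu_k\circ\overline{\widehat{\mathfrak{g}}})\big\|^2\quad\text{and}\quad B=\max_{1\le k\le N}\big\|F^*(\mu_k\circ\overline{\widehat{\mathfrak{g}}})\big\|^2,$$ and the constants $A$ and $B$ are sharp (i.e. $A$ is the largest and $B$ the smallest constant for which the respective inequality holds for all $\mathfrak{f}$).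
   Context: For $w\in\mathbb{C}^N$, $D_w$ denotes the diagonal matrix with diagonal entries $w_1,\dots,w_N$. The symbol $\circ$ denotes the entrywise product, and $\overline{\,\cdot\,}$ denotes entrywise complex conjugation. $\phi_k(j)$ is the $j$-th entry of $\phi_k$. The inner product is $\langle f,h\rangle=\sum_j f(j)\overline{h(j)}$, and norms are Euclidean. *)

theory Defs
  imports "HOL-Analysis.Analysis"
begin

(* The library's inner product on complex ^ 'n is the real one; this is the Hermitian
   product, linear in the first argument. Its induced norm is the library's norm. *)
definition cinner :: "complex ^ 'n \<Rightarrow> complex ^ 'n \<Rightarrow> complex" where
  "cinner f h = (\<Sum>j\<in>UNIV. f $ j * cnj (h $ j))"

definition cnj_vec :: "complex ^ 'n \<Rightarrow> complex ^ 'n" where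
  "cnj_vec v = (\<chi> i. cnj (v $ i))"

definition conj_transpose :: "complex ^ 'n ^ 'm \<Rightarrow> complex ^ 'm ^ 'n" where
  "conj_transpose M = (\<chi> i j. cnj (M $ j $ i))"

definition diag_mat :: "complex ^ 'n \<Rightarrow> complex ^ 'n ^ 'n" where
  "diag_mat w = (\<chi> i j. if i = j then w $ i else 0)"

definition mat_of_columns :: "('k \<Rightarrow> complex ^ 'n) \<Rightarrow> complex ^ 'k ^ 'n" where
  "mat_of_columns v = (\<chi> i j. v j $ i)"

(* vec.span is the complex linear span, for the scalar multiplication *s. *)
definition orthonormal_basis :: "('n \<Rightarrow> complex ^ 'n) \<Rightarrow> bool" where
  "orthonormal_basis \<phi> \<longleftrightarrow>
     (\<forall>i j. cinner (\<phi> i) (\<phi> j) = (if i = j then 1 else 0)) \<and> vec.span (range \<phi>) = UNIV"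

(* The operator \<Phi> D_w \<Phi>^*, where \<Phi> has the columns \<phi> j. *)
definition multiplier_op :: "('n \<Rightarrow> complex ^ 'n) \<Rightarrow> complex ^ 'n \<Rightarrow> complex ^ 'n ^ 'n" where
  "multiplier_op \<phi> w =
     mat_of_columns \<phi> ** diag_mat w ** conj_transpose (mat_of_columns \<phi>)"

(* In the library, * on vectors is the entrywise product. *)
definition frame_vec ::
  "('n \<Rightarrow> complex ^ 'n) \<Rightarrow> ('s::finite \<Rightarrow> complex ^ 'n) \<Rightarrow> complex ^ 'n \<Rightarrow> 's \<Rightarrow> 'n \<Rightarrow> complex ^ 'n" where
  "frame_vec \<phi> f g m l = \<phi> l * (multiplier_op \<phi> (f m) *v g)"

definition mu :: "('n \<Rightarrow> complex ^ 'n) \<Rightarrow> 'n \<Rightarrow> complex ^ 'n" where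
  "mu \<phi> j = (\<chi> k. cnj (\<phi> k $ j))"

definition ghat :: "('n \<Rightarrow> complex ^ 'n) \<Rightarrow> complex ^ 'n \<Rightarrow> complex ^ 'n" where
  "ghat \<phi> g = conj_transpose (mat_of_columns \<phi>) *v g"

definition bound_at ::
  "('n \<Rightarrow> complex ^ 'n) \<Rightarrow> ('s::finite \<Rightarrow> complex ^ 'n) \<Rightarrow> complex ^ 'n \<Rightarrow> 'n \<Rightarrow> real" where
  "bound_at \<phi> f g k =
     (norm (conj_transpose (mat_of_columns f) *v (mu \<phi> k * cnj_vec (ghat \<phi> g))))\<^sup>2"

end

theory Submission
  imports Defs
begin

text \<open>Moving the factor \<open>A\<^sub>m g\<close> to the other side of the inner product and applying Parseval's
  identity in \<open>l\<close> turns the frame form into \<open>\<Sum>k. \<bar>h k\<bar>\<^sup>2 * c k\<close>, where \<open>c k\<close>, the sum over \<open>m\<close> of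
  \<open>\<bar>(A\<^sub>m g) k\<bar>\<^sup>2\<close>, is the bound at \<open>k\<close>. The frame operator is thus diagonal in the standard basis,
  so its optimal bounds are the extreme diagonal entries, attained at standard basis vectors.\<close>

lemma norm_vec_squared: "(norm v)\<^sup>2 = (\<Sum>j\<in>UNIV. (cmod (v $ j))\<^sup>2)" for v :: "complex ^ 'n"
  by (simp add: norm_vec_def L2_set_def sum_nonneg)

text \<open>Orthonormality of the columns says that the conjugate transpose is a left inverse of the
  matrix. The matrix is square, so it is a right inverse too, which makes the rows
  orthonormal.\<close>

lemma orthonormal_basis_completeness:
  fixes \<phi> :: "'n::finite \<Rightarrow> complex ^ 'n"
  assumes "orthonormal_basis \<phi>"
  shows "(\<Sum>l\<in>UNIV. \<phi> l $ i * cnj (\<phi> l $ j)) = (if i = j then 1 else 0)"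
proof -
  let ?M = "mat_of_columns \<phi>"
  have "conj_transpose ?M ** ?M = mat 1"
    using assms
    by (simp add: orthonormal_basis_def cinner_def vec_eq_iff matrix_matrix_mult_def mat_def
        conj_transpose_def mat_of_columns_def mult.commute)
  then have "?M ** conj_transpose ?M = mat 1"
    by (simp add: matrix_left_right_inverse)
  then show ?thesis
    by (simp add: vec_eq_iff matrix_matrix_mult_def mat_def conj_transpose_def mat_of_columns_def)
qed

lemma Parseval_orthonormal_basis:
  fixes \<phi> :: "'n::finite \<Rightarrow> complex ^ 'n"
  assumes "orthonormal_basis \<phi>"
  shows "(\<Sum>l\<in>UNIV. (cmod (cinner v (\<phi> l)))\<^sup>2) = (norm v)\<^sup>2"
proof -
  \<comment> \<open>The computation runs over the complex numbers, where a squared modulus factors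
    as \<open>z * cnj z\<close>.\<close>
  have "complex_of_real (\<Sum>l\<in>UNIV. (cmod (cinner v (\<phi> l)))\<^sup>2)
      = (\<Sum>l\<in>UNIV. \<Sum>i\<in>UNIV. \<Sum>j\<in>UNIV. v $ i * cnj (v $ j) * (\<phi> l $ j * cnj (\<phi> l $ i)))"
    by (simp only: of_real_sum complex_norm_square)
       (simp add: cinner_def sum_product mult_ac)
  also have "\<dots> = (\<Sum>i\<in>UNIV. \<Sum>j\<in>UNIV. \<Sum>l\<in>UNIV. v $ i * cnj (v $ j) * (\<phi> l $ j * cnj (\<phi> l $ i)))"
    \<comment> \<open>The sum over \<open>l\<close> moves past \<open>i\<close>, then past
      \<open>j\<close> for each fixed \<open>i\<close>, so that completeness applies to the
      innermost sum.\<close>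
    by (subst sum.swap, intro sum.cong refl sum.swap)
  also have "\<dots> = (\<Sum>i\<in>UNIV. v $ i * cnj (v $ i))"
    by (simp flip: sum_distrib_left add: orthonormal_basis_completeness[OF assms] if_distrib
        cong: if_cong)
  also have "\<dots> = complex_of_real ((norm v)\<^sup>2)"
    by (simp only: norm_vec_squared of_real_sum complex_norm_square)
  finally show ?thesis
    by (simp only: of_real_eq_iff)
qed

lemma multiplier_op_mult_vec_nth:
  "(multiplier_op \<phi> w *v g) $ k = (\<Sum>i\<in>UNIV. \<phi> i $ k * w $ i * ghat \<phi> g $ i)"
proof -
  have "diag_mat w *v ghat \<phi> g = w * ghat \<phi> g"
    by (simp add: vec_eq_iff diag_mat_def matrix_vector_mult_def if_distrib[of "\<lambda>a. a * _"]
        cong: if_cong)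
  then have "multiplier_op \<phi> w *v g = mat_of_columns \<phi> *v (w * ghat \<phi> g)"
    by (simp add: multiplier_op_def ghat_def flip: matrix_vector_mul_assoc)
  then show ?thesis
    by (simp add: matrix_vector_mult_def mat_of_columns_def mult.assoc)
qed

text \<open>Entry \<open>m\<close> of the vector whose norm defines \<open>bound_at\<close> is the
  conjugate of entry \<open>k\<close> of \<open>multiplier_op \<phi> (f m) *v g\<close>, and
  conjugation preserves the modulus.\<close>

lemma bound_at_eq_sum:
  "bound_at \<phi> f g k = (\<Sum>m\<in>UNIV. (cmod ((multiplier_op \<phi> (f m) *v g) $ k))\<^sup>2)"
proof -
  have "(conj_transpose (mat_of_columns f) *v (mu \<phi> k * cnj_vec (ghat \<phi> g))) $ m
      = cnj ((multiplier_op \<phi> (f m) *v g) $ k)" for m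
    unfolding multiplier_op_mult_vec_nth
    by (simp add: matrix_vector_mult_def conj_transpose_def mat_of_columns_def mu_def cnj_vec_def
        mult_ac)
  then show ?thesis
    by (simp add: bound_at_def norm_vec_squared)
qed

lemma frame_form_eq_weighted_sum:
  fixes \<phi> :: "'n::finite \<Rightarrow> complex ^ 'n"
  assumes "orthonormal_basis \<phi>"
  shows "(\<Sum>m\<in>UNIV. \<Sum>l\<in>UNIV. (cmod (cinner h (frame_vec \<phi> f g m l)))\<^sup>2)
    = (\<Sum>k\<in>UNIV. bound_at \<phi> f g k * (cmod (h $ k))\<^sup>2)"
proof -
  \<comment> \<open>The adjoint of entrywise multiplication by a vector is entrywise multiplication
    by its conjugate.\<close>
  have "cinner h (frame_vec \<phi> f g m l)
      = cinner (h * cnj_vec (multiplier_op \<phi> (f m) *v g)) (\<phi> l)" for m l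
    by (simp add: cinner_def frame_vec_def cnj_vec_def mult_ac)
  then have "(\<Sum>m\<in>UNIV. \<Sum>l\<in>UNIV. (cmod (cinner h (frame_vec \<phi> f g m l)))\<^sup>2)
      = (\<Sum>m\<in>UNIV. \<Sum>k\<in>UNIV. (cmod ((multiplier_op \<phi> (f m) *v g) $ k))\<^sup>2 * (cmod (h $ k))\<^sup>2)"
    by (simp add: Parseval_orthonormal_basis[OF assms] norm_vec_squared cnj_vec_def norm_mult
        power_mult_distrib mult.commute)
  also have "\<dots> = (\<Sum>k\<in>UNIV. bound_at \<phi> f g k * (cmod (h $ k))\<^sup>2)"
    by (subst sum.swap) (simp add: bound_at_eq_sum sum_distrib_right)
  finally show ?thesis .
qed

theorem theorem5:
  fixes \<phi> :: "'n::finite \<Rightarrow> complex ^ 'n"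
    and f :: "'s::finite \<Rightarrow> complex ^ 'n"
    and g :: "complex ^ 'n"
  assumes "orthonormal_basis \<phi>"
  defines "A \<equiv> (MIN k. bound_at \<phi> f g k)"
    and "B \<equiv> (MAX k. bound_at \<phi> f g k)"
    and "Q \<equiv> \<lambda>h. \<Sum>m\<in>UNIV. \<Sum>l\<in>UNIV. (cmod (cinner h (frame_vec \<phi> f g m l)))\<^sup>2"
  shows "(\<forall>h. A * (norm h)\<^sup>2 \<le> Q h \<and> Q h \<le> B * (norm h)\<^sup>2)
    \<and> (\<forall>a. (\<forall>h. a * (norm h)\<^sup>2 \<le> Q h) \<longrightarrow> a \<le> A)
    \<and> (\<forall>b. (\<forall>h. Q h \<le> b * (norm h)\<^sup>2) \<longrightarrow> B \<le> b)"
proof -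
  let ?c = "bound_at \<phi> f g"
  have Q: "Q h = (\<Sum>k\<in>UNIV. ?c k * (cmod (h $ k))\<^sup>2)" for h
    unfolding Q_def by (rule frame_form_eq_weighted_sum[OF assms(1)])
  have "Q (axis k 1) = ?c k" for k
    by (simp add: Q axis_def if_distrib[of cmod] if_distrib[of "\<lambda>x. x\<^sup>2"] if_distrib[of "\<lambda>x. _ * x"]
        cong: if_cong)
  moreover have "norm (axis k 1 :: complex ^ 'n) = 1" for k
    by simp
  \<comment> \<open>Any admissible constant is tested at the unit vector \<open>axis k 1\<close>,
    for every \<open>k\<close>, since the extremal index is not yet fixed.\<close>
  ultimately have sharp: "(\<forall>h. a * (norm h)\<^sup>2 \<le> Q h) \<Longrightarrow> a \<le> ?c k"
      "(\<forall>h. Q h \<le> a * (norm h)\<^sup>2) \<Longrightarrow> ?c k \<le> a" for a k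
    by (metis mult.right_neutral one_power2)+
  have "A \<le> ?c k" "?c k \<le> B" for k
    by (simp_all add: A_def B_def)
  then have "A * (norm h)\<^sup>2 \<le> Q h" "Q h \<le> B * (norm h)\<^sup>2" for h
    by (auto simp: Q norm_vec_squared sum_distrib_left intro!: sum_mono mult_right_mono)
  \<comment> \<open>Extrema over a finite nonempty index type are attained; \<open>sharp\<close> at
    such an index gives optimality.\<close>
  moreover have "A \<in> range ?c" "B \<in> range ?c"
    unfolding A_def B_def by (intro Min_in Max_in; simp)+
  ultimately show ?thesis
    using sharp by blast
qed

end
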